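(* Let $\mu$ be a positive Borel measure on $[0,1)$. Then the following conditions are equivalent: (i) $\int_{[0,1)}\log\frac{2}{1-t}\,d\mu(t)<\infty$. (ii) For any given $f\in\mathcal B$ (the Bloch space), the integral $\int_{[0,1)}\frac{f(t)}{1-tz}\,d\mu(t)$ converges for all $z\in\mathbb D$ and the resulting function $I_\mu(f)$ of $z$ is analytic in $\mathbb D$. (iii) For any given $f\in BMOA$, the integral $\int_{[0,1)}\frac{f(t)}{1-tz}\,d\mu(t)$ converges for all $z\in\mathbb D$ and the resulting function $I_\mu(f)$ of $z$ is analytic in $\mathbb D$.
   Context: $\mathbb D=\{z\in\mathbb C:|z|<1\}$. The Bloch space $\mathcal B$ is the set of analytic functions $f$ in $\mathbb D$ with $\|f\|_{\mathcal B}=|f(0)|+\sup_{z\in\mathbb D}(1-|z|^2)|f'(z)|<\infty$. For $a\in\mathbb D$ let $\varphi_a(z)=\frac{a-z}{1-\overline a z}$; $BMOA$ is the set of analytic functions $f$ in $\mathbb D$ with $\|f\|_{BMOA}=|f(0)|+\sup_{a\in\mathbb D}\|f\circ\varphi_a-f(a)\|_{H^2}<\infty$, where $H^2$ is the Hardy space. For an analytic function $f$ in $\mathbb D$, $I_\mu(f)(z)=\int_{[0,1)}\frac{f(t)}{1-tz}\,d\mu(t)$ whenever the right-hand side makes sense and defines an analytic function in $\mathbb D$. *)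

theory Defs
  imports "HOL-Analysis.Analysis"
begin

text \<open>
  Analytic functions in the unit disc are represented by total functions on the complex numbers;
  every notion below depends only on the values in \<^term>\<open>ball (0::complex) 1\<close>.
  The (semi)norms are \<^typ>\<open>ennreal\<close>-valued, so that an unbounded supremum is really infinite.
\<close>

definition bloch_norm :: "(complex \<Rightarrow> complex) \<Rightarrow> ennreal" where
  "bloch_norm f = ennreal (norm (f 0)) +
     (SUP z\<in>ball 0 1. ennreal ((1 - (norm z)\<^sup>2) * norm (deriv f z)))"

definition bloch_space :: "(complex \<Rightarrow> complex) set" where
  "bloch_space = {f. f analytic_on ball 0 1 \<and> bloch_norm f < \<infinity>}"

definition H2_mean :: "real \<Rightarrow> (complex \<Rightarrow> complex) \<Rightarrow> real" where
  "H2_mean r g =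
     sqrt (1 / (2 * pi) * integral {0..2 * pi} (\<lambda>\<theta>. (norm (g (of_real r * cis \<theta>)))\<^sup>2))"

text \<open>
  The Hardy space norm, meant for \<open>g\<close> analytic in the disc; it is infinite iff \<open>g\<close> is not
  in the Hardy space.
\<close>

definition H2_norm :: "(complex \<Rightarrow> complex) \<Rightarrow> ennreal" where
  "H2_norm g = (SUP r\<in>{0<..<1}. ennreal (H2_mean r g))"

definition disc_aut :: "complex \<Rightarrow> complex \<Rightarrow> complex" where
  "disc_aut a z = (a - z) / (1 - cnj a * z)"

definition BMOA_norm :: "(complex \<Rightarrow> complex) \<Rightarrow> ennreal" where
  "BMOA_norm f = ennreal (norm (f 0)) +
     (SUP a\<in>ball 0 1. H2_norm (\<lambda>z. (f \<circ> disc_aut a) z - f a))"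

definition BMOA :: "(complex \<Rightarrow> complex) set" where
  "BMOA = {f. f analytic_on ball 0 1 \<and> BMOA_norm f < \<infinity>}"

definition I_integrand :: "(complex \<Rightarrow> complex) \<Rightarrow> complex \<Rightarrow> real \<Rightarrow> complex" where
  "I_integrand f z t = f (of_real t) / (1 - of_real t * z)"

text \<open>
  The Bochner integral is \<open>0\<close> for non-integrable functions, so \<open>I_op\<close> is meaningful only
  where the integrand is integrable; \<open>I_op_well_defined\<close> records this
  (convergence of the integral is integrability) together with analyticity.
\<close>

definition I_op :: "real measure \<Rightarrow> (complex \<Rightarrow> complex) \<Rightarrow> complex \<Rightarrow> complex" where
  "I_op \<mu> f z = (LINT t|\<mu>. I_integrand f z t)"

definition I_op_well_defined :: "real measure \<Rightarrow> (complex \<Rightarrow> complex) \<Rightarrow> bool" where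
  "I_op_well_defined \<mu> f \<longleftrightarrow>
     (\<forall>z\<in>ball 0 1. integrable \<mu> (I_integrand f z)) \<and> I_op \<mu> f analytic_on ball 0 1"

end

theory Submission
  imports Defs "HOL-Complex_Analysis.Complex_Analysis"
begin

text \<open>
  The circle of implications is closed by two facts about growth along the radius and one
  inclusion.

  A Bloch function grows at most logarithmically: integrating
  \<open>|f'(s)| \<le> B / (1 - s\<^sup>2)\<close> along \<open>[0, t]\<close> gives \<open>|f(t)| \<le> C ln (2 / (1 - t))\<close>
  (\<open>bloch_space_radial_growth\<close>). So, if the logarithm is \<open>\<mu>\<close>-integrable, then so is \<open>f\<close> on the
  radius, and expanding \<open>1 / (1 - t z)\<close> as a geometric series and integrating termwise exhibits
  \<open>I_op \<mu> f\<close> as a power series converging in the disc (\<open>I_op_well_defined_of_integrable\<close>).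

  BMOA is contained in the Bloch space, because
  \<open>(1 - |a|\<^sup>2) |f'(a)|\<close> is the modulus at the origin of the derivative of
  \<open>f \<circ> \<phi>\<^sub>a - f(a)\<close>, and that is bounded by the Hardy norm (\<open>BMOA_subset_bloch_space\<close>).

  Conversely the logarithmic growth is attained inside BMOA: the function
  \<open>ln 2 - Ln (1 - z)\<close> takes the value \<open>ln (2 / (1 - t))\<close> at \<open>t\<close>, so convergence of
  its integral at \<open>z = 0\<close> is the integrability of the logarithm. It lies in BMOA since
  its imaginary part is bounded, and this suffices (\<open>bounded_Im_in_BMOA\<close>).

  The two facts on Hardy norms both come from the mean value property applied to the
  square of an analytic function, which replaces Parseval's identity and the
  Cauchy-Schwarz inequality.
\<close>

section \<open>Mean values on circles\<close>

lemma circle_mean_value: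
  assumes "h holomorphic_on ball 0 1" "0 < r" "r < 1"
  shows "((\<lambda>\<theta>. h (of_real r * cis \<theta>)) has_integral (2 * of_real pi * h 0)) {0..2 * pi}"
proof -
  have "((\<lambda>u. h u / (u - 0)) has_contour_integral (2 * of_real pi * \<i> * h 0)) (circlepath 0 r)"
    by (rule Cauchy_integral_circlepath_simple)
      (use assms in \<open>auto intro: holomorphic_on_subset\<close>)
  then have "((\<lambda>\<theta>. h (of_real r * cis \<theta>) / (of_real r * cis \<theta>) * of_real r * \<i> * cis \<theta>)
      has_integral (2 * of_real pi * \<i> * h 0)) {0..2 * pi}"
    by (simp add: circlepath_def has_contour_integral_part_circlepath_iff)
  also have "(\<lambda>\<theta>. h (of_real r * cis \<theta>) / (of_real r * cis \<theta>) * of_real r * \<i> * cis \<theta>)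
      = (\<lambda>\<theta>. \<i> * h (of_real r * cis \<theta>))"
    using \<open>0 < r\<close> by (auto simp: fun_eq_iff)
  finally have "((\<lambda>\<theta>. - \<i> * (\<i> * h (of_real r * cis \<theta>))) has_integral
      - \<i> * (2 * of_real pi * \<i> * h 0)) {0..2 * pi}"
    by (rule has_integral_mult_right)
  moreover have "- \<i> * (\<i> * w) = w" "- \<i> * (c * \<i> * w) = c * w" for c w
    by (simp_all add: complex_eq_iff)
  ultimately show ?thesis
    by (simp only:)
qed

lemma continuous_on_circle:
  assumes "h holomorphic_on ball 0 1" "0 < r" "r < 1"
  shows "continuous_on A (\<lambda>\<theta>. h (of_real r * cis \<theta>))"
proof (rule continuous_on_compose2[where g = h and t = "ball 0 1"])
  show "continuous_on (ball 0 1) h"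
    using assms(1) by (rule holomorphic_on_imp_continuous_on)
  show "continuous_on A (\<lambda>\<theta>. of_real r * cis \<theta>)"
    by (intro continuous_intros)
qed (use assms in \<open>auto simp: norm_mult\<close>)

text \<open>
  Write \<open>g(z) = z h(z)\<close>. Then \<open>g'(0)\<^sup>2 = h(0)\<^sup>2\<close> is the mean of \<open>h\<^sup>2\<close> over the circle of
  radius \<open>r\<close>, so its modulus is at most the mean of \<open>|h|\<^sup>2 = |g|\<^sup>2 / r\<^sup>2\<close>; let \<open>r\<close> tend to 1.
\<close>

lemma norm_deriv_0_le_H2_norm:
  assumes hol: "g holomorphic_on ball 0 1" and g0: "g 0 = 0"
  shows "ennreal (norm (deriv g 0)) \<le> H2_norm g"
proof -
  obtain h where h: "h holomorphic_on ball 0 1"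
      and gh: "\<And>z. norm z < 1 \<Longrightarrow> g z = z * h z" and h0: "deriv g 0 = h 0"
    using Schwarz3[OF hol g0] by blast
  have mean: "r * norm (h 0) \<le> H2_mean r g" if r: "0 < r" "r < 1" for r
  proof -
    have sq: "((\<lambda>\<theta>. (h (of_real r * cis \<theta>))\<^sup>2) has_integral 2 * of_real pi * (h 0)\<^sup>2) {0..2 * pi}"
      by (rule circle_mean_value[of "\<lambda>z. (h z)\<^sup>2"]) (use h r in \<open>auto intro: holomorphic_intros\<close>)
    have "norm (2 * of_real pi * (h 0)\<^sup>2) \<le> integral {0..2 * pi} (\<lambda>\<theta>. (norm (h (of_real r * cis \<theta>)))\<^sup>2)"
      unfolding integral_unique[OF sq, symmetric]
    proof (rule integral_norm_bound_integral)
      show "(\<lambda>\<theta>. (h (of_real r * cis \<theta>))\<^sup>2) integrable_on {0..2 * pi}"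
        using sq by blast
      show "(\<lambda>\<theta>. (norm (h (of_real r * cis \<theta>)))\<^sup>2) integrable_on {0..2 * pi}"
        by (intro integrable_continuous_real continuous_intros continuous_on_circle h r)
    qed (simp add: norm_power)
    then have "r\<^sup>2 * (2 * pi * (norm (h 0))\<^sup>2) \<le>
        r\<^sup>2 * integral {0..2 * pi} (\<lambda>\<theta>. (norm (h (of_real r * cis \<theta>)))\<^sup>2)"
      by (intro mult_left_mono) (simp_all add: norm_mult norm_power)
    also have "\<dots> = integral {0..2 * pi} (\<lambda>\<theta>. (norm (g (of_real r * cis \<theta>)))\<^sup>2)"
      using r by (simp add: gh norm_mult power_mult_distrib)
    finally have "(r * norm (h 0))\<^sup>2 \<le>
        1 / (2 * pi) * integral {0..2 * pi} (\<lambda>\<theta>. (norm (g (of_real r * cis \<theta>)))\<^sup>2)"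
      by (simp add: field_simps)
    then show ?thesis
      unfolding H2_mean_def by (rule real_le_rsqrt)
  qed
  have "((\<lambda>r. ennreal (r * norm (h 0))) \<longlongrightarrow> ennreal (1 * norm (h 0))) (at_left 1)"
    by (intro tendsto_intros)
  moreover have "\<forall>\<^sub>F r in at_left (1::real). ennreal (r * norm (h 0)) \<le> H2_norm g"
  proof -
    have "ennreal (r * norm (h 0)) \<le> H2_norm g" if "r \<in> {0<..<1}" for r
      unfolding H2_norm_def using that mean[of r]
      by (intro SUP_upper2[OF that] ennreal_leI) auto
    then show ?thesis
      using eventually_at_left_real[of 0 "1::real"] by (auto elim: eventually_mono)
  qed
  ultimately have "ennreal (1 * norm (h 0)) \<le> H2_norm g"
    by (rule tendsto_upperbound) auto
  then show ?thesis
    by (simp add: h0)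
qed

text \<open>
  As \<open>g(0) = 0\<close>, the mean of \<open>g\<^sup>2\<close> over a circle vanishes; its real part is
  \<open>(Re g)\<^sup>2 - (Im g)\<^sup>2\<close>, so \<open>Re g\<close> and \<open>Im g\<close> have the same quadratic mean, and
  the mean of \<open>|g|\<^sup>2\<close> is twice that of \<open>(Im g)\<^sup>2\<close>.
\<close>

lemma H2_norm_le_bounded_Im:
  assumes hol: "g holomorphic_on ball 0 1" and g0: "g 0 = 0"
    and Im: "\<And>z. norm z < 1 \<Longrightarrow> \<bar>Im (g z)\<bar> \<le> M"
  shows "H2_norm g \<le> ennreal (sqrt 2 * M)"
  unfolding H2_norm_def
proof (intro SUP_least ennreal_leI)
  fix r :: real assume "r \<in> {0<..<1}"
  then have r: "0 < r" "r < 1" by auto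
  have M: "0 \<le> M"
    using Im[of 0] by simp
  let ?g = "\<lambda>\<theta>. g (of_real r * cis \<theta>)"
  have sq: "((\<lambda>\<theta>. (?g \<theta>)\<^sup>2) has_integral 2 * of_real pi * (g 0)\<^sup>2) {0..2 * pi}"
    by (rule circle_mean_value[of "\<lambda>z. (g z)\<^sup>2"]) (use hol r in \<open>auto intro: holomorphic_intros\<close>)
  have "((\<lambda>\<theta>. Re ((?g \<theta>)\<^sup>2)) has_integral 0) {0..2 * pi}"
    using has_integral_Re[OF sq] g0 by simp
  moreover have Im_int: "(\<lambda>\<theta>. 2 * (Im (?g \<theta>))\<^sup>2) integrable_on {0..2 * pi}"
    by (intro integrable_continuous_real continuous_intros continuous_on_circle hol r)
  ultimately have "((\<lambda>\<theta>. Re ((?g \<theta>)\<^sup>2) + 2 * (Im (?g \<theta>))\<^sup>2) has_integral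
      0 + integral {0..2 * pi} (\<lambda>\<theta>. 2 * (Im (?g \<theta>))\<^sup>2)) {0..2 * pi}"
    by (intro has_integral_add integrable_integral)
  moreover have "Re (w\<^sup>2) + 2 * (Im w)\<^sup>2 = (norm w)\<^sup>2" for w
    by (simp add: cmod_power2 Re_power2)
  ultimately have "((\<lambda>\<theta>. (norm (?g \<theta>))\<^sup>2) has_integral
      0 + integral {0..2 * pi} (\<lambda>\<theta>. 2 * (Im (?g \<theta>))\<^sup>2)) {0..2 * pi}"
    by (simp only:)
  then have "integral {0..2 * pi} (\<lambda>\<theta>. (norm (?g \<theta>))\<^sup>2) =
      integral {0..2 * pi} (\<lambda>\<theta>. 2 * (Im (?g \<theta>))\<^sup>2)"
    by (simp only: integral_unique add_0_left)
  also have "\<dots> \<le> integral {0..2 * pi} (\<lambda>\<theta>. 2 * M\<^sup>2)"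
  proof (rule integral_le[OF Im_int])
    fix \<theta>
    have "\<bar>Im (?g \<theta>)\<bar> \<le> M"
      using r by (intro Im) (simp add: norm_mult)
    then show "2 * (Im (?g \<theta>))\<^sup>2 \<le> 2 * M\<^sup>2"
      using power_mono[of "\<bar>Im (?g \<theta>)\<bar>" M 2] by simp
  qed (rule integrable_const_ivl)
  also have "\<dots> = 2 * pi * (2 * M\<^sup>2)"
    by simp
  finally have "1 / (2 * pi) * integral {0..2 * pi} (\<lambda>\<theta>. (norm (?g \<theta>))\<^sup>2) \<le> 2 * M\<^sup>2"
    by (simp add: pos_divide_le_eq mult.commute)
  then have "H2_mean r g \<le> sqrt (2 * M\<^sup>2)"
    unfolding H2_mean_def by (rule real_sqrt_le_mono)
  then show "H2_mean r g \<le> sqrt 2 * M"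
    using M by (simp add: real_sqrt_mult)
qed

section \<open>The space BMOA\<close>

text \<open>The library's Moebius functions supply that \<open>disc_aut a\<close> is a holomorphic self-map of the disc.\<close>

lemma disc_aut_eq_Moebius: "disc_aut a z = - Moebius_function 0 a z"
  by (simp add: disc_aut_def Moebius_function_simple minus_divide_left)

lemma disc_aut_in_disc: "norm a < 1 \<Longrightarrow> norm z < 1 \<Longrightarrow> norm (disc_aut a z) < 1"
  by (simp add: disc_aut_eq_Moebius Moebius_function_norm_lt_1)

lemma disc_aut_holomorphic: "norm a < 1 \<Longrightarrow> disc_aut a holomorphic_on ball 0 1"
  unfolding disc_aut_eq_Moebius[abs_def]
  by (intro holomorphic_intros Moebius_function_holomorphic)

lemma disc_aut_0 [simp]: "disc_aut a 0 = a"
  by (simp add: disc_aut_def)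

lemma disc_aut_has_derivative_0:
  "(disc_aut a has_field_derivative - of_real (1 - (norm a)\<^sup>2)) (at 0)"
proof -
  have "((\<lambda>z. (a - z) / (1 - cnj a * z)) has_field_derivative (- 1 + a * cnj a)) (at 0)"
    by (rule derivative_eq_intros refl | simp)+
  moreover have "- 1 + a * cnj a = - of_real (1 - (norm a)\<^sup>2)"
    by (simp only: of_real_diff complex_norm_square of_real_1) simp
  ultimately show ?thesis
    by (simp only: disc_aut_def[abs_def])
qed

lemma holomorphic_on_recentred:
  assumes "f holomorphic_on ball 0 1" "norm a < 1"
  shows "(\<lambda>z. (f \<circ> disc_aut a) z - f a) holomorphic_on ball 0 1"
  using assms disc_aut_in_disc
  by (intro holomorphic_intros holomorphic_on_compose_gen[OF disc_aut_holomorphic]) auto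

lemma bloch_norm_le_BMOA_norm:
  assumes hol: "f holomorphic_on ball 0 1"
  shows "bloch_norm f \<le> BMOA_norm f"
  unfolding bloch_norm_def BMOA_norm_def
proof (intro add_left_mono SUP_mono)
  fix a :: complex assume a: "a \<in> ball 0 1"
  let ?g = "\<lambda>z. (f \<circ> disc_aut a) z - f a"
  have "(f has_field_derivative deriv f a) (at a)"
    using a hol by (intro holomorphic_derivI[OF hol]) auto
  then have "(f has_field_derivative deriv f a) (at (disc_aut a 0))"
    by simp
  from DERIV_chain[OF this disc_aut_has_derivative_0]
  have "(?g has_field_derivative deriv f a * (- of_real (1 - (norm a)\<^sup>2)) - 0) (at 0)"
    by (intro DERIV_diff DERIV_const)
  then have "deriv ?g 0 = deriv f a * (- of_real (1 - (norm a)\<^sup>2))"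
    by (simp add: DERIV_imp_deriv)
  moreover have "(norm a)\<^sup>2 \<le> 1"
    using a by (simp add: power_le_one)
  ultimately have "norm (deriv ?g 0) = (1 - (norm a)\<^sup>2) * norm (deriv f a)"
    by (simp add: norm_mult del: of_real_diff)
  moreover have "ennreal (norm (deriv ?g 0)) \<le> H2_norm ?g"
    using a hol by (intro norm_deriv_0_le_H2_norm holomorphic_on_recentred) auto
  ultimately show "\<exists>b\<in>ball 0 1. ennreal ((1 - (norm a)\<^sup>2) * norm (deriv f a))
      \<le> H2_norm (\<lambda>z. (f \<circ> disc_aut b) z - f b)"
    using a by auto
qed

lemma BMOA_subset_bloch_space: "BMOA \<subseteq> bloch_space"
proof
  fix f assume "f \<in> BMOA"
  then have f: "f analytic_on ball 0 1" "BMOA_norm f < \<infinity>"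
    by (auto simp: BMOA_def)
  then have "bloch_norm f < \<infinity>"
    using le_less_trans[OF bloch_norm_le_BMOA_norm[OF analytic_imp_holomorphic]] by blast
  with f show "f \<in> bloch_space"
    by (simp add: bloch_space_def)
qed

text \<open>
  Composition with a disc automorphism preserves the bound on the imaginary part, and subtracting
  \<open>f(a)\<close> at most doubles it. Hence \<open>H2_norm_le_bounded_Im\<close> applies with a constant independent
  of \<open>a\<close>.
\<close>

lemma bounded_Im_in_BMOA:
  assumes hol: "f holomorphic_on ball 0 1"
    and Im: "\<And>z. norm z < 1 \<Longrightarrow> \<bar>Im (f z)\<bar> \<le> M"
  shows "f \<in> BMOA"
proof -
  have "(SUP a\<in>ball 0 1. H2_norm (\<lambda>z. (f \<circ> disc_aut a) z - f a)) \<le> ennreal (sqrt 2 * (2 * M))"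
  proof (intro SUP_least H2_norm_le_bounded_Im)
    fix a :: complex assume "a \<in> ball 0 1"
    then have a: "norm a < 1" by simp
    show "(\<lambda>z. (f \<circ> disc_aut a) z - f a) holomorphic_on ball 0 1"
      using hol a by (rule holomorphic_on_recentred)
    show "\<bar>Im ((f \<circ> disc_aut a) z - f a)\<bar> \<le> 2 * M" if "norm z < 1" for z
      using Im[OF a] Im[OF disc_aut_in_disc[OF a that]] by simp
  qed simp
  then have "BMOA_norm f \<le> ennreal (norm (f 0)) + ennreal (sqrt 2 * (2 * M))"
    unfolding BMOA_norm_def by (rule add_left_mono)
  also have "\<dots> < \<infinity>"
    by simp
  finally show ?thesis
    using hol by (simp add: BMOA_def analytic_on_open)
qed

text \<open>
  For \<open>z\<close> in the disc, \<open>1 - z\<close> is in the right half-plane, so its argument is less than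
  \<open>\<pi> / 2\<close> in modulus.
\<close>

lemma log_in_BMOA: "(\<lambda>z. of_real (ln 2) - Ln (1 - z)) \<in> BMOA"
proof (rule bounded_Im_in_BMOA)
  have Re: "0 < Re (1 - z)" if "norm z < 1" for z
    using complex_Re_le_cmod[of z] that by simp
  show "(\<lambda>z. of_real (ln 2) - Ln (1 - z)) holomorphic_on ball 0 1"
    by (intro holomorphic_intros) (auto simp: complex_nonpos_Reals_iff dest!: Re)
  show "\<bar>Im (of_real (ln 2) - Ln (1 - z))\<bar> \<le> pi / 2" if "norm z < 1" for z
    using Re_Ln_pos_lt_imp[OF Re[OF that]] by simp
qed

section \<open>Growth of Bloch functions\<close>

text \<open>
  Integrating \<open>|f'(s)| \<le> B / (1 - s\<^sup>2) \<le> B / (1 - s)\<close> bounds \<open>|f(t) - f(0)|\<close> by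
  \<open>B ln (1 / (1 - t))\<close>. The numerator 2 in the logarithm keeps it at least \<open>ln 2 > 0\<close>, so that
  it also absorbs the constant \<open>|f(0)|\<close>.
\<close>

lemma bloch_space_radial_growth:
  assumes "f \<in> bloch_space"
  obtains C where "\<And>t. 0 \<le> t \<Longrightarrow> t < 1 \<Longrightarrow> norm (f (of_real t)) \<le> C * ln (2 / (1 - t))"
proof -
  have hol: "f holomorphic_on ball 0 1" and fin: "bloch_norm f < \<infinity>"
    using assms by (auto simp: bloch_space_def analytic_imp_holomorphic)
  define S where "S = (SUP z\<in>ball 0 1. ennreal ((1 - (norm z)\<^sup>2) * norm (deriv f z)))"
  have "S < \<infinity>"
    using fin by (auto simp: bloch_norm_def S_def)
  then obtain B where B: "0 \<le> B" "S = ennreal B"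
    by (cases S) auto
  have bound: "(1 - (norm z)\<^sup>2) * norm (deriv f z) \<le> B" if "norm z < 1" for z
  proof -
    have "ennreal ((1 - (norm z)\<^sup>2) * norm (deriv f z)) \<le> ennreal B"
      unfolding B(2)[symmetric] S_def using that by (intro SUP_upper) auto
    then show ?thesis
      using B by simp
  qed
  have growth: "norm (f (of_real t)) \<le> norm (f 0) + B * ln (1 / (1 - t))" if t: "0 \<le> t" "t < 1" for t
  proof (cases "t = 0")
    case False
    with t have t0: "0 < t" by simp
    have "norm (f (of_real t) - f (of_real 0)) \<le> - B * ln (1 - t) - (- B * ln (1 - 0))"
    proof (rule differentiable_bound_general[OF t0,
          where f' = "\<lambda>s. deriv f (of_real s)" and \<phi>' = "\<lambda>s. B / (1 - s)"])
      show "continuous_on {0..t} (\<lambda>s. f (of_real s))"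
        using t by (intro continuous_on_compose2[OF holomorphic_on_imp_continuous_on[OF hol]]
            continuous_intros) auto
      show "continuous_on {0..t} (\<lambda>s. - B * ln (1 - s))"
        using t by (intro continuous_intros) auto
      fix s assume s: "0 < s" "s < t"
      have "(f has_field_derivative deriv f (of_real s)) (at (of_real s))"
        using s t by (intro holomorphic_derivI[OF hol]) auto
      then show "((\<lambda>s. f (of_real s)) has_vector_derivative deriv f (of_real s)) (at s)"
        by (rule has_vector_derivative_real_field)
      show "((\<lambda>s. - B * ln (1 - s)) has_vector_derivative B / (1 - s)) (at s)"
        unfolding has_real_derivative_iff_has_vector_derivative[symmetric]
        using s t by (auto intro!: derivative_eq_intros simp: field_simps)
      have "(1 - s) * norm (deriv f (of_real s)) \<le> (1 - s\<^sup>2) * norm (deriv f (of_real s))"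
        using s t by (intro mult_right_mono) (auto simp: power2_eq_square mult_left_le)
      also have "\<dots> \<le> B"
        using bound[of "of_real s"] s t by simp
      finally show "norm (deriv f (of_real s)) \<le> B / (1 - s)"
        using s t by (simp add: field_simps)
    qed
    then have "norm (f (of_real t) - f 0) \<le> B * ln (1 / (1 - t))"
      using t by (simp add: ln_div)
    then show ?thesis
      using norm_triangle_sub[of "f (of_real t)" "f 0"] by simp
  qed simp
  show thesis
  proof (rule that)
    fix t :: real assume t: "0 \<le> t" "t < 1"
    have le: "ln 2 \<le> ln (2 / (1 - t))" "ln (1 / (1 - t)) \<le> ln (2 / (1 - t))"
      using t by (simp_all add: field_simps)
    have "norm (f 0) = norm (f 0) / ln 2 * ln 2"
      by simp
    also have "\<dots> \<le> norm (f 0) / ln 2 * ln (2 / (1 - t))"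
      by (intro mult_left_mono le) simp
    finally have "norm (f 0) \<le> norm (f 0) / ln 2 * ln (2 / (1 - t))" .
    moreover have "B * ln (1 / (1 - t)) \<le> B * ln (2 / (1 - t))"
      by (intro mult_left_mono le B)
    ultimately show "norm (f (of_real t)) \<le> (norm (f 0) / ln 2 + B) * ln (2 / (1 - t))"
      using growth[OF t] by (simp add: distrib_right)
  qed
qed

section \<open>The integral operator\<close>

lemma borel_measurable_of_continuous_on:
  assumes "sets \<mu> = sets (restrict_space borel A)" "continuous_on A f"
  shows "f \<in> borel_measurable \<mu>"
  using borel_measurable_continuous_on_restrict[OF assms(2)]
  by (simp cong: measurable_cong_sets add: assms(1))

text \<open>
  On the radius \<open>f(t) / (1 - t z)\<close> is the sum of \<open>f(t) t\<^sup>n z\<^sup>n\<close>. These terms are dominated by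
  \<open>|f(t)| |z|\<^sup>n\<close>, whose integrals form a convergent geometric series, so the sum is integrable
  and \<open>I_op \<mu> f\<close> is the power series with coefficients \<open>\<integral> f(t) t\<^sup>n d\<mu>(t)\<close>.
\<close>

lemma I_op_well_defined_of_integrable:
  assumes sets: "sets \<mu> = sets (restrict_space borel {0..<1})"
    and int: "integrable \<mu> (\<lambda>t. f (of_real t))"
  shows "I_op_well_defined \<mu> f"
proof -
  have sp: "space \<mu> = {0..<1}"
    using sets_eq_imp_space_eq[OF sets] by (simp add: space_restrict_space)
  have [measurable]: "(\<lambda>t. f (of_real t)) \<in> borel_measurable \<mu>"
    using int by auto
  have [measurable]: "complex_of_real \<in> borel_measurable \<mu>"
    by (rule borel_measurable_of_continuous_on[OF sets]) (intro continuous_intros)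
  let ?s = "\<lambda>z n t. f (of_real t) * of_real t ^ n * z ^ n"
  have le: "norm (?s z n t) \<le> norm (f (of_real t)) * norm z ^ n"
    if "t \<in> space \<mu>" for z :: complex and n t
  proof -
    have "norm (f (of_real t)) * (\<bar>t\<bar> ^ n * norm z ^ n) \<le> norm (f (of_real t)) * (1 * norm z ^ n)"
      using that by (intro mult_left_mono mult_right_mono) (auto simp: sp power_le_one)
    then show ?thesis
      by (simp add: norm_mult norm_power mult.assoc)
  qed
  have term_int: "integrable \<mu> (?s z n)" for z n
    by (rule Bochner_Integration.integrable_bound[of \<mu> "\<lambda>t. norm z ^ n *\<^sub>R f (of_real t)"])
      (use int le in \<open>auto simp: mult.commute\<close>)
  have main: "integrable \<mu> (I_integrand f z) \<and>
      (\<lambda>n. (LINT t|\<mu>. f (of_real t) * of_real t ^ n) * (z - 0) ^ n) sums I_op \<mu> f z"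
    if z: "z \<in> ball 0 1" for z
  proof -
    have z1: "norm z < 1"
      using z by simp
    have geo: "summable (\<lambda>n. c * norm z ^ n)" for c
      using z1 by (intro summable_mult summable_geometric) simp
    have sum_eq: "(\<Sum>n. ?s z n t) = I_integrand f z t" if t: "t \<in> space \<mu>" for t
    proof -
      have "norm (of_real t * z) < 1"
        using t z1 mult_left_le_one_le[of "norm z" t] by (simp add: sp norm_mult)
      then have "(\<lambda>n. f (of_real t) * (of_real t * z) ^ n) sums (f (of_real t) * (1 / (1 - of_real t * z)))"
        by (intro sums_mult geometric_sums)
      then show ?thesis
        by (simp add: sums_iff I_integrand_def power_mult_distrib mult.assoc)
    qed
    have ae: "AE t in \<mu>. summable (\<lambda>n. norm (?s z n t))"
      by (intro AE_I2 summable_comparison_test'[OF geo]) (use le in auto)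
    have sm: "summable (\<lambda>n. LINT t|\<mu>. norm (?s z n t))"
    proof (rule summable_comparison_test'[OF geo])
      fix n :: nat
      have "(LINT t|\<mu>. norm (?s z n t)) \<le> (LINT t|\<mu>. norm (f (of_real t)) * norm z ^ n)"
        by (intro integral_mono integrable_norm term_int integrable_mult_left int le)
      then show "norm (LINT t|\<mu>. norm (?s z n t)) \<le> (LINT t|\<mu>. norm (f (of_real t))) * norm z ^ n"
        by simp
    qed
    have "integrable \<mu> (I_integrand f z)"
      using integrable_suminf[OF term_int ae sm] sum_eq by (simp cong: Bochner_Integration.integrable_cong)
    moreover have "(\<lambda>n. LINT t|\<mu>. ?s z n t) sums I_op \<mu> f z"
      using sums_integral[OF term_int ae sm] sum_eq
      by (simp add: I_op_def cong: Bochner_Integration.integral_cong)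
    ultimately show ?thesis
      by simp
  qed
  then have "I_op \<mu> f analytic_on ball 0 1"
    by (intro power_series_analytic[where a = "\<lambda>n. LINT t|\<mu>. f (of_real t) * of_real t ^ n"]) blast
  with main show ?thesis
    by (simp add: I_op_well_defined_def)
qed

lemma bloch_I_op_well_defined:
  assumes sets: "sets \<mu> = sets (restrict_space borel {0..<1})"
    and fin: "(\<integral>\<^sup>+ t. ennreal (ln (2 / (1 - t))) \<partial>\<mu>) < \<infinity>"
    and f: "f \<in> bloch_space"
  shows "I_op_well_defined \<mu> f"
proof (rule I_op_well_defined_of_integrable[OF sets])
  have sp: "space \<mu> = {0..<1}"
    using sets_eq_imp_space_eq[OF sets] by (simp add: space_restrict_space)
  obtain C where C: "\<And>t. 0 \<le> t \<Longrightarrow> t < 1 \<Longrightarrow> norm (f (of_real t)) \<le> C * ln (2 / (1 - t))"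
    using bloch_space_radial_growth[OF f] by blast
  have "f holomorphic_on ball 0 1"
    using f by (simp add: bloch_space_def analytic_imp_holomorphic)
  then have "continuous_on (ball 0 1) f"
    by (rule holomorphic_on_imp_continuous_on)
  then have "continuous_on {0..<1} (\<lambda>t::real. f (of_real t))"
    by (rule continuous_on_compose2) (auto intro: continuous_intros)
  then have meas: "(\<lambda>t. f (of_real t)) \<in> borel_measurable \<mu>"
    by (rule borel_measurable_of_continuous_on[OF sets])
  have "integrable \<mu> (\<lambda>t. ln (2 / (1 - t)))"
  proof (rule integrableI_nonneg)
    show "(\<lambda>t. ln (2 / (1 - t))) \<in> borel_measurable \<mu>"
      by (intro borel_measurable_of_continuous_on[OF sets] continuous_intros) auto
  qed (use fin sp in auto)
  then have "integrable \<mu> (\<lambda>t. C * ln (2 / (1 - t)))"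
    by simp
  then show "integrable \<mu> (\<lambda>t. f (of_real t))"
    by (rule Bochner_Integration.integrable_bound[OF _ meas])
      (use C sp in \<open>auto intro!: order_trans[OF _ abs_ge_self]\<close>)
qed

lemma log_integrable_of_BMOA_well_defined:
  assumes sets: "sets \<mu> = sets (restrict_space borel {0..<1})"
    and wd: "\<And>f. f \<in> BMOA \<Longrightarrow> I_op_well_defined \<mu> f"
  shows "(\<integral>\<^sup>+ t. ennreal (ln (2 / (1 - t))) \<partial>\<mu>) < \<infinity>"
proof -
  have sp: "space \<mu> = {0..<1}"
    using sets_eq_imp_space_eq[OF sets] by (simp add: space_restrict_space)
  let ?f = "\<lambda>z. of_real (ln 2) - Ln (1 - z)"
  have "integrable \<mu> (I_integrand ?f 0)"
    using wd[OF log_in_BMOA] by (simp add: I_op_well_defined_def)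
  then have "(\<integral>\<^sup>+ t. ennreal (norm (I_integrand ?f 0 t)) \<partial>\<mu>) < \<infinity>"
    by (simp add: integrable_iff_bounded)
  moreover have "norm (I_integrand ?f 0 t) = ln (2 / (1 - t))" if "t \<in> space \<mu>" for t
  proof -
    have t: "0 \<le> t" "t < 1"
      using that by (auto simp: sp)
    have "?f (of_real t) = of_real (ln 2) - Ln (of_real (1 - t))"
      by simp
    also have "\<dots> = of_real (ln (2 / (1 - t)))"
      using t by (subst Ln_of_real) (simp_all add: ln_div)
    finally show ?thesis
      using t by (simp add: I_integrand_def)
  qed
  ultimately show ?thesis
    by (simp cong: nn_integral_cong)
qed

theorem theorem2p1:
  fixes \<mu> :: "real measure"
  assumes "sets \<mu> = sets (restrict_space borel {0..<1})"
  shows "((\<integral>\<^sup>+ t. ennreal (ln (2 / (1 - t))) \<partial>\<mu>) < \<infinity>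
            \<longleftrightarrow> (\<forall>f\<in>bloch_space. I_op_well_defined \<mu> f))
       \<and> ((\<forall>f\<in>bloch_space. I_op_well_defined \<mu> f)
            \<longleftrightarrow> (\<forall>f\<in>BMOA. I_op_well_defined \<mu> f))"
  using bloch_I_op_well_defined[OF assms] log_integrable_of_BMOA_well_defined[OF assms]
    BMOA_subset_bloch_space by blast

end
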